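(* Let $D=(V,A)$ be a (finite) digraph and $w\in\{0,1\}^A$ be such that every dicut of $D$ has weight at least $2$ under $w$. Let $A_1=\{a\in A: w(a)=1\}$. If the subdigraph formed by the arcs of $A_1$ is weakly bridge-connected, then there exist two disjoint dijoins $J_1,J_2$ of $D$ with $J_1,J_2\subseteq A_1$.
   Context: For $U\subseteq V$, $\delta^+(U)$ is the set of arcs with tail in $U$ and head in $V\setminus U$, and $\delta^-(U)$ is the set of arcs with head in $U$ and tail in $V\setminus U$. A dicut of $D$ is an arc set $\delta^+(U)$ where $\emptyset\neq U\subsetneq V$ and $\delta^-(U)=\emptyset$; its weight is $\sum_{a\in\delta^+(U)}w(a)$. A dijoin is a subset $J\subseteq A$ intersecting every dicut (equivalently, contracting $J$ makes $D$ strongly connected). A bridge of an undirected graph is an edge whose deletion increases the number of connected components; a graph is bridge-connected if all its bridges (if any) lie in the same connected component. A digraph is weakly bridge-connected if its underlying undirected graph is bridge-connected. The subdigraph formed by $A_1$ consists of the arcs in $A_1$ together with their endpoints. *)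

theory Defs
  imports "Graph_Theory.Digraph_Component"
begin

definition out_cut :: "('a,'b) pre_digraph \<Rightarrow> 'a set \<Rightarrow> 'b set" where
  "out_cut D U = {a \<in> arcs D. tail D a \<in> U \<and> head D a \<in> verts D - U}"

definition in_cut :: "('a,'b) pre_digraph \<Rightarrow> 'a set \<Rightarrow> 'b set" where
  "in_cut D U = {a \<in> arcs D. head D a \<in> U \<and> tail D a \<in> verts D - U}"

text \<open>A dicut may be the empty arc set; this happens exactly when the digraph is
  disconnected, and then there is no dijoin.\<close>
definition dicut :: "('a,'b) pre_digraph \<Rightarrow> 'b set \<Rightarrow> bool" where
  "dicut D C \<longleftrightarrow> (\<exists>U. U \<noteq> {} \<and> U \<subset> verts D \<and> in_cut D U = {} \<and> C = out_cut D U)"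

definition dijoin :: "('a,'b) pre_digraph \<Rightarrow> 'b set \<Rightarrow> bool" where
  "dijoin D J \<longleftrightarrow> J \<subseteq> arcs D \<and> (\<forall>C. dicut D C \<longrightarrow> J \<inter> C \<noteq> {})"

text \<open>The underlying undirected multigraph of a digraph \<open>G\<close> is represented by \<open>G\<close> itself,
  with the orientation of its arcs ignored: every arc is one edge, and parallel or
  antiparallel arcs remain distinct edges. Since \<open>mk_symmetric\<close> merges parallel arcs, it is
  used below only for reachability, after any arc deletion. Connected components are
  given by their vertex sets.\<close>
definition weak_components :: "('a,'b) pre_digraph \<Rightarrow> 'a set set" where
  "weak_components G = pre_digraph.sccs_verts (with_proj (mk_symmetric G))"

definition bridges :: "('a,'b) pre_digraph \<Rightarrow> 'b set" where
  "bridges G = {e \<in> arcs G.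
     card (weak_components G) < card (weak_components (pre_digraph.del_arc G e))}"

definition weakly_bridge_connected :: "('a,'b) pre_digraph \<Rightarrow> bool" where
  "weakly_bridge_connected G \<longleftrightarrow>
     (bridges G \<noteq> {} \<longrightarrow>
       (\<exists>C \<in> weak_components G. \<forall>e \<in> bridges G. tail G e \<in> C \<and> head G e \<in> C))"

definition arc_subdigraph :: "('a,'b) pre_digraph \<Rightarrow> 'b set \<Rightarrow> ('a,'b) pre_digraph" where
  "arc_subdigraph D B =
     \<lparr> verts = tail D ` B \<union> head D ` B, arcs = B, tail = tail D, head = head D \<rparr>"

end

theory Submission
  imports Defs Complex_Main
begin

text \<open>It suffices to find an integral vector \<open>x\<close> on \<open>A1\<close> whose total on every dicut is at least
  \<open>1\<close> and at most the weight of the dicut minus \<open>1\<close>: then \<open>{a. x a \<ge> 1}\<close> and its complement in \<open>A1\<close>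
  are dijoins. On a connected component \<open>K\<close> of \<open>A1\<close> every integral vector \<open>b\<close> with \<open>b(K) = 0\<close> is the
  net outflow of some \<open>x\<close>, so what is needed is such a \<open>b\<close> with \<open>1 \<le> b(I) \<le> m(I) - 1\<close> for all \<open>I\<close> in a
  crossing family of cuts of \<open>K\<close>, where \<open>m(I) \<ge> 2\<close> is the size of the cut. The vector \<open>m/2\<close> is a real
  solution, and uncrossing shows that there is an integral one.

  In a bridgeless component all cuts have at least two arcs. In the component with the bridges,
  only the dicuts that split no other component matter, and these have all their weight inside it.\<close>

section \<open>Homogeneous linear systems\<close>

text \<open>Gaussian elimination, one equation per induction step: an equation with a nonzero
  coefficient eliminates one unknown.\<close>

lemma homogeneous_system_nontrivial_solution:
  fixes a :: "'e \<Rightarrow> 'v \<Rightarrow> real"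
  assumes "finite E" and "finite W" and "card E < card W"
  shows "\<exists>d. (\<exists>v\<in>W. d v \<noteq> 0) \<and> (\<forall>e\<in>E. (\<Sum>v\<in>W. a e v * d v) = 0)"
  using assms
proof (induction E arbitrary: W a rule: finite_induct)
  case empty
  then have "W \<noteq> {}" by auto
  then show ?case by (intro exI[of _ "\<lambda>_. 1"]) auto
next
  case (insert e E)
  show ?case
  proof (cases "\<forall>v\<in>W. a e v = 0")
    case True
    from insert.IH[of W a] insert.prems insert.hyps
    obtain d where "\<exists>v\<in>W. d v \<noteq> 0" "\<forall>f\<in>E. (\<Sum>v\<in>W. a f v * d v) = 0" by auto
    with True show ?thesis by (intro exI[of _ d]) auto
  next
    case False
    then obtain u where u: "u \<in> W" "a e u \<noteq> 0" by blast
    let ?W = "W - {u}"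
    have "card E < card ?W"
      using insert.prems insert.hyps u by simp
    \<comment> \<open>The coefficients of equation \<open>f\<close> after subtracting the multiple
      of equation \<open>e\<close> that cancels \<open>u\<close>.\<close>
    with insert.IH[of ?W "\<lambda>f v. a f v - a f u / a e u * a e v"] insert.prems
    obtain d where d: "\<exists>v\<in>?W. d v \<noteq> 0"
      "\<forall>f\<in>E. (\<Sum>v\<in>?W. (a f v - a f u / a e u * a e v) * d v) = 0" by auto
    \<comment> \<open>The value at \<open>u\<close> is the one that equation \<open>e\<close>
      forces.\<close>
    define c where "c = d(u := - (\<Sum>v\<in>?W. a e v * d v) / a e u)"
    have c: "(\<Sum>v\<in>W. a f v * c v) = a f u * c u + (\<Sum>v\<in>?W. a f v * d v)" for f
      using insert.prems u by (simp add: sum.remove[of W u] c_def)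
    have "(\<Sum>v\<in>W. a f v * c v) = 0" if "f \<in> insert e E" for f
    proof (cases "f = e")
      case True
      then show ?thesis unfolding c using u by (simp add: c_def)
    next
      case False
      with that d have "(\<Sum>v\<in>?W. (a f v - a f u / a e u * a e v) * d v) = 0" by blast
      also have "(\<Sum>v\<in>?W. (a f v - a f u / a e u * a e v) * d v)
          = (\<Sum>v\<in>?W. a f v * d v) - a f u / a e u * (\<Sum>v\<in>?W. a e v * d v)"
        by (simp add: left_diff_distrib sum_subtractf sum_distrib_left mult.assoc)
      finally show ?thesis unfolding c using u by (simp add: c_def)
    qed
    moreover have "\<exists>v\<in>W. c v \<noteq> 0" using d by (auto simp: c_def)
    ultimately show ?thesis by blast
  qed
qed

lemma twice_card_image_le:
  assumes "finite W" and "\<And>v. v \<in> W \<Longrightarrow> 2 \<le> card {u\<in>W. f u = f v}"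
  shows "2 * card (f ` W) \<le> card W"
proof -
  have "2 * card (f ` W) = (\<Sum>l\<in>f ` W. 2)" by simp
  also have "\<dots> \<le> (\<Sum>l\<in>f ` W. card {u\<in>W. f u = l})"
    using assms(2) by (intro sum_mono) auto
  also have "\<dots> = card W"
    using sum.image_gen[OF assms(1), of "\<lambda>_. 1 :: nat" f] by simp
  finally show ?thesis .
qed

text \<open>If all fibres have at least two elements, there are at most \<open>card W\<close> equations, and one of
  them is redundant because both families of fibres partition \<open>W\<close>.\<close>

lemma balanced_on_two_fibrations:
  fixes f :: "'v \<Rightarrow> 'b" and g :: "'v \<Rightarrow> 'c"
  assumes "finite W" and "W \<noteq> {}"
    and f2: "\<And>v. v \<in> W \<Longrightarrow> 2 \<le> card {u\<in>W. f u = f v}"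
    and g2: "\<And>v. v \<in> W \<Longrightarrow> 2 \<le> card {u\<in>W. g u = g v}"
  shows "\<exists>d :: 'v \<Rightarrow> real. (\<exists>v\<in>W. d v \<noteq> 0) \<and>
    (\<forall>l. (\<Sum>v | v \<in> W \<and> f v = l. d v) = 0) \<and> (\<forall>l. (\<Sum>v | v \<in> W \<and> g v = l. d v) = 0)"
proof -
  obtain w where w: "w \<in> W" using assms(2) by blast
  let ?E = "f ` W <+> (g ` W - {g w})"
  define a :: "'b + 'c \<Rightarrow> 'v \<Rightarrow> real" where
    "a e v = (case e of Inl l \<Rightarrow> of_bool (f v = l) | Inr l \<Rightarrow> of_bool (g v = l))" for e v
  \<comment> \<open>Each fibration has at most half as many fibres as \<open>W\<close> has points;
    dropping one fibre makes the bound strict.\<close>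
  have "card ?E = card (f ` W) + (card (g ` W) - 1)"
    using assms(1) w by (simp add: card_Plus)
  moreover have "card (g ` W) > 0"
    using assms(1,2) by (simp add: card_gt_0_iff)
  moreover have "2 * card (f ` W) \<le> card W" "2 * card (g ` W) \<le> card W"
    using twice_card_image_le f2 g2 assms(1) by blast+
  ultimately have "card ?E < card W" by linarith
  then obtain d where d: "\<exists>v\<in>W. d v \<noteq> 0" "\<forall>e\<in>?E. (\<Sum>v\<in>W. a e v * d v) = 0"
    using homogeneous_system_nontrivial_solution[of ?E W a] assms(1) by auto
  have restr: "(\<Sum>v | v \<in> W \<and> P v. d v) = (\<Sum>v\<in>W. of_bool (P v) * d v)" for P
    using assms(1) by (simp add: sum.inter_filter of_bool_def if_distrib[of "\<lambda>x. x * _"] cong: if_cong)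
  have F: "(\<Sum>v | v \<in> W \<and> f v = l. d v) = 0" for l
  proof (cases "l \<in> f ` W")
    case True
    then have "Inl l \<in> ?E" by (rule InlI)
    with d(2) have "(\<Sum>v\<in>W. a (Inl l) v * d v) = 0" by blast
    then show ?thesis unfolding restr by (simp add: a_def)
  next
    case False
    then have "{v \<in> W. f v = l} = {}" by auto
    then show ?thesis by (simp only: sum.empty)
  qed
  have G': "(\<Sum>v | v \<in> W \<and> g v = l. d v) = 0" if "l \<noteq> g w" for l
  proof (cases "l \<in> g ` W")
    case True
    with that have "Inr l \<in> ?E" by (intro InrI) simp
    with d(2) have "(\<Sum>v\<in>W. a (Inr l) v * d v) = 0" by blast
    then show ?thesis unfolding restr by (simp add: a_def)
  next
    case False
    then have "{v \<in> W. g v = l} = {}" by auto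
    then show ?thesis by (simp only: sum.empty)
  qed
  \<comment> \<open>This recovers the dropped equation: the fibres of \<open>f\<close> give total
    \<open>0\<close>, and all other fibres of \<open>g\<close> contribute \<open>0\<close> to
    it.\<close>
  have "0 = sum d W"
    using F by (subst sum.image_gen[OF assms(1), of d f]) simp
  also have "\<dots> = (\<Sum>l\<in>g ` W. \<Sum>v | v \<in> W \<and> g v = l. d v)"
    by (rule sum.image_gen[OF assms(1)])
  also have "\<dots> = (\<Sum>v | v \<in> W \<and> g v = g w. d v)"
    using G' w assms(1) by (subst sum.remove[of _ "g w"]) auto
  finally have "(\<Sum>v | v \<in> W \<and> g v = l. d v) = 0" for l
    using G' by (cases "l = g w") simp_all
  with d(1) F show ?thesis by (intro exI[of _ d]) blast
qed

section \<open>Crossing families\<close>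

text \<open>Comparable pairs meet the closure condition trivially, so it constrains only pairs that
  cross properly.\<close>

definition crossing_family :: "'a set \<Rightarrow> 'a set set \<Rightarrow> bool" where
  "crossing_family V T \<longleftrightarrow> T \<subseteq> Pow V \<and>
    (\<forall>I\<in>T. \<forall>K\<in>T. I \<inter> K \<noteq> {} \<longrightarrow> I \<union> K \<noteq> V \<longrightarrow> I \<inter> K \<in> T \<and> I \<union> K \<in> T)"

text \<open>The complement of an atom of \<open>T\<close> is the union of all members and complements of members
  of \<open>T\<close> that avoid the atom. A cover of this union by such sets with the smallest total size is
  disjoint: two intersecting sets of the cover could be uncrossed.\<close>

lemma crossing_family_atom_sum_Ints:
  fixes y :: "'a \<Rightarrow> real"
  assumes "finite V" and T: "crossing_family V T"
    and yV: "sum y V \<in> \<int>" and yT: "\<And>I. I \<in> T \<Longrightarrow> sum y I \<in> \<int>"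
    and "v \<in> V"
  shows "(\<Sum>u | u \<in> V \<and> (\<forall>I\<in>T. u \<in> I \<longleftrightarrow> v \<in> I). y u) \<in> \<int>"
proof -
  let ?C = "{u \<in> V. \<forall>I\<in>T. u \<in> I \<longleftrightarrow> v \<in> I}"
  \<comment> \<open>Every set in \<open>L\<close> has an integral sum, the complements because
    \<open>sum y V\<close> is integral.\<close>
  define L where "L = {X. X \<subseteq> V \<and> v \<notin> X \<and> (X \<in> T \<or> V - X \<in> T)}"
  have subV: "I \<subseteq> V" if "I \<in> T" for I
    using that T by (auto simp: crossing_family_def)
  have crossT: "I \<inter> K \<in> T" "I \<union> K \<in> T"
    if "I \<in> T" "K \<in> T" "I \<inter> K \<noteq> {}" "I \<union> K \<noteq> V" for I K
    using that T by (auto simp: crossing_family_def)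
  have finL: "finite L" and fin: "\<And>X. X \<in> L \<Longrightarrow> finite X"
    using assms(1) by (auto simp: L_def intro: finite_subset finite_subset[of _ "Pow V"])
  have compl: "V - ?C = \<Union>L"
  proof (intro equalityI subsetI)
    fix u assume u: "u \<in> V - ?C"
    then obtain I where I: "I \<in> T" "(u \<in> I) \<noteq> (v \<in> I)" by auto
    show "u \<in> \<Union>L"
    proof (cases "u \<in> I")
      case True
      with I subV have "I \<in> L" by (auto simp: L_def)
      with True show ?thesis by blast
    next
      case False
      have "V - (V - I) = I" using subV I by blast
      with False I have "V - I \<in> L" by (auto simp: L_def)
      with False u show ?thesis by blast
    qed
  next
    fix u assume "u \<in> \<Union>L"
    then obtain X where X: "u \<in> X" "X \<subseteq> V" "v \<notin> X" "X \<in> T \<or> V - X \<in> T"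
      unfolding L_def by blast
    have "\<exists>I\<in>T. (u \<in> I) \<noteq> (v \<in> I)"
      using X(4)
    proof
      assume "X \<in> T"
      with X(1,3) show ?thesis by (intro bexI[of _ X]) simp_all
    next
      assume "V - X \<in> T"
      with X(1,3) \<open>v \<in> V\<close> show ?thesis by (intro bexI[of _ "V - X"]) simp_all
    qed
    then have "u \<notin> ?C" by simp
    moreover have "u \<in> V" using X(1,2) by (rule subsetD[rotated])
    ultimately show "u \<in> V - ?C" by (rule DiffI[rotated])
  qed
  define cover where "cover M \<longleftrightarrow> M \<subseteq> L \<and> \<Union>M = \<Union>L" for M
  have "cover L" by (simp add: cover_def)
  then obtain M where M: "cover M" and
    min: "\<And>M'. cover M' \<Longrightarrow> sum card M \<le> sum card M'"
    using ex_has_least_nat[of cover L "sum card"] by blast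
  have MsubL: "M \<subseteq> L" "finite M" and UnM: "\<Union>M = \<Union>L"
    using M finL by (auto simp: cover_def intro: finite_subset)
  have finM: "finite X" if "X \<in> M" for X using that MsubL fin by blast
  \<comment> \<open>Merging \<open>X\<close> and \<open>Y\<close> into their union keeps the cover
    and lowers its total size by at least \<open>card (X \<inter> Y)\<close>.\<close>
  have swap: False
    if X: "X \<in> M" and Y: "Y \<in> M" and Z: "Z \<in> L" and "X \<noteq> Y" and XY: "X \<inter> Y \<noteq> {}" and "Z = X \<union> Y"
    for X Y Z
  proof -
    let ?M = "insert Z (M - {X, Y})"
    have "\<Union>?M = \<Union>M" using X Y \<open>Z = X \<union> Y\<close> by auto
    then have "cover ?M" using MsubL Z UnM by (auto simp: cover_def)
    then have "sum card M \<le> sum card ?M" by (rule min)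
    also have "\<dots> \<le> card Z + sum card (M - {X, Y})"
      using MsubL by (subst sum.insert_if) auto
    also have "sum card M = card X + card Y + sum card (M - {X, Y})"
      using MsubL X Y \<open>X \<noteq> Y\<close> by (subst sum.subset_diff[of "{X, Y}"]) auto
    moreover have "card Z + card (X \<inter> Y) = card X + card Y"
      using card_Un_Int[OF finM[OF X] finM[OF Y]] \<open>Z = X \<union> Y\<close> by simp
    moreover have "card (X \<inter> Y) > 0" using XY finM[OF X] by (simp add: card_gt_0_iff)
    ultimately show False by linarith
  qed
  \<comment> \<open>Unless the two sets are nested, the members \<open>X\<close> and
    \<open>V - Y\<close> cross, so \<open>X - Y\<close> is in \<open>T\<close>. Trimming
    \<open>X\<close> to \<open>X - Y\<close> keeps the cover, because \<open>Y\<close> stays in it,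
    and lowers the total size.\<close>
  have mixed: False
    if X: "X \<in> M" "X \<in> T" and Y: "Y \<in> M" "V - Y \<in> T" and "X \<noteq> Y" and XY: "X \<inter> Y \<noteq> {}" for X Y
  proof -
    have YL: "Y \<subseteq> V" "v \<notin> X" "X \<in> L" "Y \<in> L" using X Y MsubL by (auto simp: L_def)
    show False
    proof (cases "X \<subseteq> Y \<or> Y \<subseteq> X")
      case True
      then have "X \<union> Y = X \<or> X \<union> Y = Y" by blast
      with YL have "X \<union> Y \<in> L" by metis
      with swap X Y \<open>X \<noteq> Y\<close> XY show False by blast
    next
      case False
      have eq: "X \<inter> (V - Y) = X - Y" using subV[OF X(2)] by blast
      have "X - Y \<in> T"
        using crossT(1)[OF X(2) Y(2)] False YL unfolding eq by blast
      with YL X subV have Z: "X - Y \<in> L" by (auto simp: L_def)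
      let ?M = "insert (X - Y) (M - {X})"
      have "\<Union>?M = \<Union>M" using X Y \<open>X \<noteq> Y\<close> by auto
      then have "cover ?M" using MsubL Z UnM by (auto simp: cover_def)
      then have "sum card M \<le> sum card ?M" by (rule min)
      also have "\<dots> \<le> card (X - Y) + sum card (M - {X})"
        using MsubL by (subst sum.insert_if) auto
      also have "sum card M = card X + sum card (M - {X})"
        using MsubL X by (simp add: sum.remove)
      moreover have "card (X - Y) < card X"
        using XY finM[OF X(1)] by (intro psubset_card_mono) auto
      ultimately show False by linarith
    qed
  qed
  have disj: "X \<inter> Y = {}" if X: "X \<in> M" and Y: "Y \<in> M" and "X \<noteq> Y" for X Y
  proof (rule ccontr)
    assume XY: "X \<inter> Y \<noteq> {}"
    have XL: "X \<subseteq> V" "v \<notin> X" "X \<in> T \<or> V - X \<in> T" and YL: "Y \<subseteq> V" "v \<notin> Y" "Y \<in> T \<or> V - Y \<in> T"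
      using X Y MsubL by (auto simp: L_def)
    consider "X \<in> T" "Y \<in> T" | "V - X \<in> T" "V - Y \<in> T"
      | "X \<in> T" "V - Y \<in> T" | "V - X \<in> T" "Y \<in> T" using XL YL by blast
    then show False
    proof cases
      case 1
      then have "X \<union> Y \<in> T" using XY XL YL \<open>v \<in> V\<close> crossT(2) by blast
      then show False using swap[OF X Y _ \<open>X \<noteq> Y\<close> XY refl] XL YL by (auto simp: L_def)
    next
      case 2
      \<comment> \<open>Both complements contain \<open>v\<close> and miss the nonempty set
        \<open>X \<inter> Y\<close>, so the closure condition applies to them.\<close>
      have eq: "(V - X) \<inter> (V - Y) = V - (X \<union> Y)" by blast
      have "V - (X \<union> Y) \<in> T"
        using crossT(1)[OF 2] XY XL YL \<open>v \<in> V\<close> unfolding eq by blast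
      then show False using swap[OF X Y _ \<open>X \<noteq> Y\<close> XY refl] XL YL by (auto simp: L_def)
    next
      case 3
      then show False using mixed X Y \<open>X \<noteq> Y\<close> XY by blast
    next
      case 4
      then show False using mixed X Y \<open>X \<noteq> Y\<close> XY by blast
    qed
  qed
  have "sum y (\<Union>M) = (\<Sum>X\<in>M. sum y X)"
    using MsubL finM disj by (subst sum.Union_disjoint) auto
  also have "\<dots> \<in> \<int>"
  proof (rule Ints_sum)
    fix X assume "X \<in> M"
    then have X: "X \<subseteq> V" "X \<in> T \<or> V - X \<in> T" using MsubL by (auto simp: L_def)
    then show "sum y X \<in> \<int>"
    proof (elim disjE)
      assume "V - X \<in> T"
      then have "sum y V - sum y (V - X) \<in> \<int>" using yV yT by (intro Ints_diff)
      then show ?thesis using X assms(1) by (simp add: sum_diff)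
    qed (use yT in blast)
  qed
  finally have "sum y (V - ?C) \<in> \<int>" unfolding compl UnM .
  then have "sum y V - sum y (V - ?C) \<in> \<int>" using yV by (intro Ints_diff)
  moreover have "sum y (V - ?C) = sum y V - sum y ?C"
    using assms(1) by (intro sum_diff) auto
  ultimately show ?thesis by simp
qed

text \<open>Uncrossing: \<open>sum y\<close> is modular, \<open>p\<close> is supermodular on
  crossing pairs, and \<open>p\<close> never exceeds \<open>sum y\<close>. Equality at two sets
  forces equality at their intersection and union.\<close>

lemma crossing_family_tight:
  fixes y p :: "_ \<Rightarrow> real"
  assumes "finite V" and F: "crossing_family V F"
    and p: "\<And>I K. \<lbrakk>I \<in> F; K \<in> F; I \<inter> K \<noteq> {}; I \<union> K \<noteq> V\<rbrakk> \<Longrightarrow> p I + p K \<le> p (I \<inter> K) + p (I \<union> K)"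
    and y: "\<And>I. I \<in> F \<Longrightarrow> p I \<le> sum y I"
  shows "crossing_family V {I \<in> F. sum y I = p I}"
  unfolding crossing_family_def
proof (intro conjI ballI impI)
  show "{I \<in> F. sum y I = p I} \<subseteq> Pow V" using F by (auto simp: crossing_family_def)
  fix I K
  assume I: "I \<in> {I \<in> F. sum y I = p I}" and K: "K \<in> {I \<in> F. sum y I = p I}"
    and *: "I \<inter> K \<noteq> {}" "I \<union> K \<noteq> V"
  then have FF: "I \<inter> K \<in> F" "I \<union> K \<in> F" using F by (auto simp: crossing_family_def)
  have "finite I" "finite K"
    using I K F \<open>finite V\<close> by (auto simp: crossing_family_def intro: finite_subset)
  then have "sum y (I \<union> K) + sum y (I \<inter> K) = sum y I + sum y K"
    by (rule sum.union_inter)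
  then have "sum y (I \<inter> K) = p (I \<inter> K) \<and> sum y (I \<union> K) = p (I \<union> K)"
    using p[of I K] y[OF FF(1)] y[OF FF(2)] I K * by simp
  then show "I \<inter> K \<in> {I \<in> F. sum y I = p I}" "I \<union> K \<in> {I \<in> F. sum y I = p I}"
    using FF by simp_all
qed

text \<open>A labelling of the points whose fibres are the atoms of \<open>T\<close>, in the form
  that \<open>balanced_on_two_fibrations\<close> takes.\<close>

definition members_at :: "'a set set \<Rightarrow> 'a \<Rightarrow> 'a set set" where
  "members_at T v = {I \<in> T. v \<in> I}"

text \<open>The total of \<open>y\<close> on an atom is integral, so an atom cannot contain exactly
  one fractional entry.\<close>

lemma two_fractional_in_atom:
  fixes y :: "'a \<Rightarrow> real"
  assumes "finite V" and "crossing_family V T" and "sum y V \<in> \<int>" and "\<And>I. I \<in> T \<Longrightarrow> sum y I \<in> \<int>"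
    and W: "W = {v \<in> V. y v \<notin> \<int>}" and "v \<in> W"
  shows "2 \<le> card {u \<in> W. members_at T u = members_at T v}"
proof (rule ccontr)
  let ?C = "{u \<in> V. members_at T u = members_at T v}"
  let ?D = "{u \<in> W. members_at T u = members_at T v}"
  have fin: "finite ?C" "finite ?D" using assms(1) W by auto
  have "?C = {u \<in> V. \<forall>I\<in>T. u \<in> I \<longleftrightarrow> v \<in> I}"
    by (auto simp: members_at_def)
  then have C: "sum y ?C \<in> \<int>"
    using crossing_family_atom_sum_Ints[of V T y v] assms by auto
  assume "\<not> 2 \<le> card ?D"
  moreover have "{v} \<subseteq> ?D" using \<open>v \<in> W\<close> by blast
  ultimately have "?D = {v}"
    using fin card_seteq[of ?D "{v}"] by simp
  moreover have "sum y (?C - ?D) \<in> \<int>"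
    using W by (intro Ints_sum) auto
  moreover have "sum y (?C - ?D) = sum y ?C - sum y ?D"
    using fin W by (intro sum_diff) auto
  ultimately have "sum y ?C - y v \<in> \<int>" by simp
  with C have "sum y ?C - (sum y ?C - y v) \<in> \<int>" by (rule Ints_diff)
  then show False using \<open>v \<in> W\<close> W by simp
qed

text \<open>A member of \<open>T\<close> is a union of atoms, and \<open>d\<close> cancels on the
  part of each atom in \<open>W\<close>.\<close>

lemma sum_member_eq_0:
  fixes d :: "'a \<Rightarrow> real"
  assumes "finite I" and "I \<in> T"
    and d: "\<And>l. (\<Sum>v | v \<in> W \<and> members_at T v = l. d v) = 0"
  shows "(\<Sum>v\<in>I. if v \<in> W then d v else 0) = 0"
proof -
  have "(\<Sum>v\<in>I. if v \<in> W then d v else 0) = sum d (I \<inter> W)"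
    using assms(1) by (simp add: sum.inter_restrict)
  also have "\<dots> = (\<Sum>l\<in>members_at T ` (I \<inter> W). \<Sum>v | v \<in> I \<inter> W \<and> members_at T v = l. d v)"
    using assms(1) by (intro sum.image_gen) auto
  also have "\<dots> = (\<Sum>l\<in>members_at T ` (I \<inter> W). \<Sum>v | v \<in> W \<and> members_at T v = l. d v)"
  proof (rule sum.cong[OF refl])
    fix l assume l: "l \<in> members_at T ` (I \<inter> W)"
    \<comment> \<open>A label that contains \<open>I\<close> is carried only by points of
      \<open>I\<close>, so restricting its fibre to \<open>I\<close> removes nothing.\<close>
    then have "I \<in> l" using \<open>I \<in> T\<close> by (auto simp: members_at_def)
    then have "{v. v \<in> I \<inter> W \<and> members_at T v = l} = {v. v \<in> W \<and> members_at T v = l}"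
      by (auto simp: members_at_def)
    then show "(\<Sum>v | v \<in> I \<inter> W \<and> members_at T v = l. d v) = (\<Sum>v | v \<in> W \<and> members_at T v = l. d v)"
      by simp
  qed
  also have "\<dots> = 0" by (simp add: d)
  finally show ?thesis .
qed

text \<open>A pair \<open>(a, b)\<close> stands for a slack \<open>a + e * b\<close> that is affine
  in the step length \<open>e\<close>. As in a ratio test, \<open>e\<close> is the least
  \<open>a / - b\<close> over the decreasing slacks; slacks that are zero stay constant.\<close>

lemma affine_first_zero:
  fixes Q :: "(real \<times> real) set"
  assumes "finite Q"
    and nonneg: "\<And>a b. (a, b) \<in> Q \<Longrightarrow> 0 \<le> a \<and> (a = 0 \<longrightarrow> b = 0)"
    and "\<exists>(a, b) \<in> Q. b < 0"
  obtains e where "\<And>a b. (a, b) \<in> Q \<Longrightarrow> 0 \<le> a + e * b"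
    and "\<exists>(a, b) \<in> Q. a \<noteq> 0 \<and> a + e * b = 0"
proof -
  define N where "N = {(a, b) \<in> Q. b < 0}"
  define e where "e = Min ((\<lambda>(a, b). a / - b) ` N)"
  have N: "finite N" "N \<noteq> {}" "\<And>a b. (a, b) \<in> N \<longleftrightarrow> (a, b) \<in> Q \<and> b < 0"
    using assms finite_subset[of N Q] by (auto simp: N_def)
  then have "e \<in> (\<lambda>(a, b). a / - b) ` N"
    unfolding e_def by (intro Min_in) auto
  then obtain a0 b0 where 0: "(a0, b0) \<in> N" "e = a0 / - b0" by auto
  have min: "e \<le> a / - b" if "(a, b) \<in> N" for a b
    unfolding e_def using N that by (intro Min_le) force+
  have "0 \<le> e"
    using 0 N nonneg by (auto intro: divide_nonneg_neg)
  show thesis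
  proof (rule that[of e])
    fix a b assume ab: "(a, b) \<in> Q"
    show "0 \<le> a + e * b"
    proof (cases "b < 0")
      case True
      with min ab N have "e \<le> a / - b" by blast
      with True show ?thesis by (simp add: field_simps)
    next
      case False
      with \<open>0 \<le> e\<close> nonneg[OF ab] show ?thesis by simp
    qed
  next
    show "\<exists>(a, b) \<in> Q. a \<noteq> 0 \<and> a + e * b = 0"
      using 0 N nonneg by (intro bexI[of _ "(a0, b0)"]) auto
  qed
qed

text \<open>Integrality of the intersection of two base polyhedra. A point with fractional entries is moved
  along a direction that keeps the integral entries and the tight constraints, until a further
  constraint becomes tight or a further entry becomes integral.\<close>

lemma crossing_sandwich_integral:
  fixes y :: "'a \<Rightarrow> real" and p q :: "'a set \<Rightarrow> int"
  assumes "finite V" and F: "crossing_family V F"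
    and p: "\<And>I K. \<lbrakk>I \<in> F; K \<in> F; I \<inter> K \<noteq> {}; I \<union> K \<noteq> V\<rbrakk> \<Longrightarrow> p I + p K \<le> p (I \<inter> K) + p (I \<union> K)"
    and q: "\<And>I K. \<lbrakk>I \<in> F; K \<in> F; I \<inter> K \<noteq> {}; I \<union> K \<noteq> V\<rbrakk> \<Longrightarrow> q (I \<inter> K) + q (I \<union> K) \<le> q I + q K"
    and "sum y V = of_int k"
    and "\<And>I. I \<in> F \<Longrightarrow> of_int (p I) \<le> sum y I"
    and "\<And>I. I \<in> F \<Longrightarrow> sum y I \<le> of_int (q I)"
  shows "\<exists>b :: 'a \<Rightarrow> int. sum b V = k \<and> (\<forall>I\<in>F. p I \<le> sum b I \<and> sum b I \<le> q I)"
proof -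
  \<comment> \<open>The number of fractional entries and of constraints that are not tight is the
    induction measure.\<close>
  define W where "W y = {v \<in> V. y v \<notin> \<int>}" for y :: "'a \<Rightarrow> real"
  define P where "P y = {I \<in> F. sum y I \<noteq> of_int (p I)}" for y :: "'a \<Rightarrow> real"
  define Q where "Q y = {I \<in> F. sum y I \<noteq> of_int (q I)}" for y :: "'a \<Rightarrow> real"
  have subV: "I \<subseteq> V" "finite I" if "I \<in> F" for I
    using F that \<open>finite V\<close> by (auto simp: crossing_family_def intro: finite_subset)
  have "finite F"
    using F \<open>finite V\<close> by (auto simp: crossing_family_def intro: finite_subset[of _ "Pow V"])
  then have fin: "finite (W y)" "finite (P y)" "finite (Q y)" for y
    using \<open>finite V\<close> by (auto simp: W_def P_def Q_def)
  show ?thesis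
    using assms(5-7)
  proof (induction "card (W y) + card (P y) + card (Q y)" arbitrary: y rule: less_induct)
    case less
    note yk = less.prems(1) and py = less.prems(2) and qy = less.prems(3)
    show ?case
    proof (cases "W y = {}")
      case True
      \<comment> \<open>Without fractional entries the floor only changes the type from real to
        integer.\<close>
      then have y: "of_int \<lfloor>y v\<rfloor> = y v" if "v \<in> V" for v
        using that by (auto simp: W_def elim: Ints_cases)
      have sum_floor: "of_int (\<Sum>v\<in>X. \<lfloor>y v\<rfloor>) = sum y X" if "X \<subseteq> V" for X
        unfolding of_int_sum using y that by (intro sum.cong) auto
      have "(\<Sum>v\<in>V. \<lfloor>y v\<rfloor>) = k" using sum_floor[of V] yk by (metis of_int_eq_iff subset_refl)
      moreover have "p I \<le> (\<Sum>v\<in>I. \<lfloor>y v\<rfloor>) \<and> (\<Sum>v\<in>I. \<lfloor>y v\<rfloor>) \<le> q I" if "I \<in> F" for I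
        using sum_floor[OF subV(1)[OF that]] py[OF that] qy[OF that] by (metis of_int_le_iff)
      ultimately show ?thesis by (intro exI[of _ "\<lambda>v. \<lfloor>y v\<rfloor>"]) auto
    next
      case False
      define T1 where "T1 = {I \<in> F. sum y I = of_int (p I)}"
      define T2 where "T2 = {I \<in> F. sum y I = of_int (q I)}"
      have "crossing_family V T1"
        unfolding T1_def using p py
        by (intro crossing_family_tight[OF \<open>finite V\<close> F]) (simp_all flip: of_int_add)
      \<comment> \<open>Negation turns tight upper bounds into tight lower bounds, so the uncrossing
        lemma covers \<open>q\<close> as well.\<close>
      moreover have "crossing_family V {I \<in> F. sum (\<lambda>v. - y v) I = of_int (- q I)}"
      proof (rule crossing_family_tight[OF \<open>finite V\<close> F])
        fix I K assume "I \<in> F" "K \<in> F" "I \<inter> K \<noteq> {}" "I \<union> K \<noteq> V"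
        then have "- q I + - q K \<le> - q (I \<inter> K) + - q (I \<union> K)" using q[of I K] by simp
        then show "real_of_int (- q I) + of_int (- q K) \<le> of_int (- q (I \<inter> K)) + of_int (- q (I \<union> K))"
          unfolding of_int_add[symmetric] of_int_le_iff .
      qed (use qy in \<open>simp add: sum_negf\<close>)
      then have "crossing_family V T2" by (simp add: T2_def sum_negf)
      ultimately have two: "2 \<le> card {u \<in> W y. members_at T u = members_at T v}"
        if "v \<in> W y" "T = T1 \<or> T = T2" for v T
        using that yk \<open>finite V\<close>
        by (intro two_fractional_in_atom[of V T y "W y" v]) (auto simp: W_def T1_def T2_def)
      obtain d0 :: "'a \<Rightarrow> real" where d0: "\<exists>v\<in>W y. d0 v \<noteq> 0"
        "\<And>l. (\<Sum>v | v \<in> W y \<and> members_at T1 v = l. d0 v) = 0"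
        "\<And>l. (\<Sum>v | v \<in> W y \<and> members_at T2 v = l. d0 v) = 0"
        using balanced_on_two_fibrations[of "W y" "members_at T1" "members_at T2"] two fin False
        by blast
      \<comment> \<open>Extension by zero keeps the integral entries of \<open>y\<close> fixed along
        \<open>d\<close>.\<close>
      define d where "d v = (if v \<in> W y then d0 v else 0)" for v
      have dT1: "sum d I = 0" if "I \<in> T1" for I
        using sum_member_eq_0[of I T1 d0 "W y"] that d0 subV by (simp add: d_def T1_def)
      have dT2: "sum d I = 0" if "I \<in> T2" for I
        using sum_member_eq_0[of I T2 d0 "W y"] that d0 subV by (simp add: d_def T2_def)
      have dV: "sum d V = 0"
      proof -
        have "W y \<inter> V = W y" by (auto simp: W_def)
        then have "sum d V = sum d0 (W y)"
          using \<open>finite V\<close> by (simp add: d_def sum.inter_restrict[symmetric] Int_commute)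
        also have "\<dots> = 0"
          using d0(2) fin by (subst sum.image_gen[of _ _ "members_at T1"]) simp_all
        finally show ?thesis .
      qed
      \<comment> \<open>All slacks with their slopes along \<open>d\<close>: those of the bounds
        \<open>p\<close> and \<open>q\<close>, and the distances of each entry to its floor and
        ceiling.\<close>
      define S where "S = (\<lambda>I. (sum y I - of_int (p I), sum d I)) ` F \<union>
        (\<lambda>I. (of_int (q I) - sum y I, - sum d I)) ` F \<union>
        (\<lambda>v. (y v - of_int \<lfloor>y v\<rfloor>, d v)) ` V \<union> (\<lambda>v. (of_int \<lceil>y v\<rceil> - y v, - d v)) ` V"
      have "finite S" using \<open>finite F\<close> \<open>finite V\<close> by (simp add: S_def)
      moreover have S_nonneg: "0 \<le> a \<and> (a = 0 \<longrightarrow> b = 0)" if "(a, b) \<in> S" for a b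
      proof -
        have d_int: "d v = 0" if "y v \<in> \<int>" for v
          using that by (auto simp: d_def W_def)
        from that consider I where "I \<in> F" "a = sum y I - of_int (p I)" "b = sum d I"
          | I where "I \<in> F" "a = of_int (q I) - sum y I" "b = - sum d I"
          | v where "a = y v - of_int \<lfloor>y v\<rfloor>" "b = d v"
          | v where "a = of_int \<lceil>y v\<rceil> - y v" "b = - d v"
          unfolding S_def by auto
        then show ?thesis
        proof cases
          case 1
          then show ?thesis using py dT1 by (auto simp: T1_def)
        next
          case 2
          then show ?thesis using qy dT2 by (auto simp: T2_def)
        next
          case 3
          then show ?thesis using d_int[of v] by (auto simp: Ints_def)
        next
          case 4
          then show ?thesis using d_int[of v] by (auto simp: Ints_def)
        qed
      qed
      \<comment> \<open>A nonzero entry of \<open>d\<close> occurs as a slope with both signs,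
        through the floor and the ceiling.\<close>
      moreover have "\<exists>(a, b) \<in> S. b < 0"
      proof -
        obtain v where "v \<in> W y" "d0 v \<noteq> 0" using d0(1) by blast
        then have "v \<in> V" "d v \<noteq> 0" by (auto simp: d_def W_def)
        then have "(y v - of_int \<lfloor>y v\<rfloor>, d v) \<in> S" "(of_int \<lceil>y v\<rceil> - y v, - d v) \<in> S"
          by (auto simp: S_def)
        moreover have "d v < 0 \<or> - d v < 0" using \<open>d v \<noteq> 0\<close> by linarith
        ultimately show ?thesis by blast
      qed
      ultimately obtain e where e: "\<And>a b. (a, b) \<in> S \<Longrightarrow> 0 \<le> a + e * b"
        and e0: "\<exists>(a, b) \<in> S. a \<noteq> 0 \<and> a + e * b = 0"
        using affine_first_zero[of S] by blast
      define z where "z v = y v + e * d v" for v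
      have sum_z: "sum z I = sum y I + e * sum d I" for I
        by (simp add: z_def sum.distrib sum_distrib_left)
      have pz: "of_int (p I) \<le> sum z I" if "I \<in> F" for I
        using e[of "sum y I - of_int (p I)" "sum d I"] that unfolding sum_z S_def by auto
      have qz: "sum z I \<le> of_int (q I)" if "I \<in> F" for I
        using e[of "of_int (q I) - sum y I" "- sum d I"] that unfolding sum_z S_def by auto
      have sub: "W z \<subseteq> W y" "P z \<subseteq> P y" "Q z \<subseteq> Q y"
      proof -
        show "W z \<subseteq> W y" by (auto simp: W_def z_def d_def)
        show "P z \<subseteq> P y" using dT1 by (auto simp: P_def T1_def sum_z)
        show "Q z \<subseteq> Q y" using dT2 by (auto simp: Q_def T2_def sum_z)
      qed
      \<comment> \<open>The slack that vanishes at \<open>z\<close> was nonzero at \<open>y\<close>: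
        either a bound becomes tight or an entry becomes integral.\<close>
      have "W z \<subset> W y \<or> P z \<subset> P y \<or> Q z \<subset> Q y"
      proof -
        obtain a b where ab: "(a, b) \<in> S" "a \<noteq> 0" "a + e * b = 0" using e0 by blast
        then consider I where "I \<in> F" "a = sum y I - of_int (p I)" "b = sum d I"
          | I where "I \<in> F" "a = of_int (q I) - sum y I" "b = - sum d I"
          | v where "v \<in> V" "a = y v - of_int \<lfloor>y v\<rfloor>" "b = d v"
          | v where "v \<in> V" "a = of_int \<lceil>y v\<rceil> - y v" "b = - d v"
          unfolding S_def by auto
        then show ?thesis
        proof cases
          case 1
          with ab have "I \<in> P y" "I \<notin> P z" by (auto simp: P_def sum_z)
          with sub show ?thesis by blast
        next
          case 2
          with ab have "I \<in> Q y" "I \<notin> Q z" by (auto simp: Q_def sum_z)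
          with sub show ?thesis by blast
        next
          case 3
          with ab have "z v = of_int \<lfloor>y v\<rfloor>" by (simp add: z_def)
          then have "v \<notin> W z" by (simp add: W_def)
          moreover have "v \<in> W y" using 3 ab by (auto simp: W_def elim: Ints_cases)
          ultimately show ?thesis using sub by blast
        next
          case 4
          with ab have "z v = of_int \<lceil>y v\<rceil>" by (simp add: z_def)
          then have "v \<notin> W z" by (simp add: W_def)
          moreover have "v \<in> W y" using 4 ab by (auto simp: W_def elim: Ints_cases)
          ultimately show ?thesis using sub by blast
        qed
      qed
      then have "card (W z) < card (W y) \<or> card (P z) < card (P y) \<or> card (Q z) < card (Q y)"
        by (elim disjE) (simp_all add: fin psubset_card_mono)
      moreover have "card (W z) \<le> card (W y)" "card (P z) \<le> card (P y)" "card (Q z) \<le> card (Q y)"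
        using fin sub by (simp_all add: card_mono)
      ultimately have "card (W z) + card (P z) + card (Q z) < card (W y) + card (P y) + card (Q y)"
        by linarith
      moreover have "sum z V = of_int k" using yk dV by (simp add: sum_z)
      ultimately show ?thesis using less.hyps[of z] pz qz by blast
    qed
  qed
qed

text \<open>The bounds \<open>1\<close> and \<open>sum m I - 1\<close> are modular up to a constant,
  so both crossing inequalities hold with equality; \<open>m / 2\<close> lies between them since
  \<open>sum m I\<close> is at least \<open>2\<close>.\<close>

lemma crossing_family_halving:
  fixes m :: "'a \<Rightarrow> int"
  assumes "finite V" and "crossing_family V F" and "sum m V = 0" and m: "\<And>I. I \<in> F \<Longrightarrow> 2 \<le> sum m I"
  shows "\<exists>b. sum b V = 0 \<and> (\<forall>I\<in>F. 1 \<le> sum b I \<and> sum b I \<le> sum m I - 1)"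
proof (rule crossing_sandwich_integral[OF assms(1,2), where y = "\<lambda>v. real_of_int (m v) / 2"])
  fix I K assume "I \<in> F" "K \<in> F"
  then have "finite I" "finite K"
    using assms(1,2) by (auto simp: crossing_family_def intro: finite_subset)
  then show "sum m (I \<inter> K) - 1 + (sum m (I \<union> K) - 1) \<le> sum m I - 1 + (sum m K - 1)"
    using sum.union_inter[of I K m] by simp
next
  have half: "(\<Sum>v\<in>I. real_of_int (m v) / 2) = of_int (sum m I) / 2" for I
    by (simp add: sum_divide_distrib)
  show "(\<Sum>v\<in>V. real_of_int (m v) / 2) = of_int 0" unfolding half assms(3) by simp
  fix I assume "I \<in> F"
  then have "2 \<le> real_of_int (sum m I)" using m by (metis of_int_le_iff of_int_numeral)
  then show "real_of_int 1 \<le> (\<Sum>v\<in>I. real_of_int (m v) / 2)"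
    "(\<Sum>v\<in>I. real_of_int (m v) / 2) \<le> real_of_int (sum m I - 1)"
    unfolding half by simp_all
qed simp_all

section \<open>Integral flows on connected graphs\<close>

text \<open>Send \<open>b v\<close> units from each \<open>v\<close> to a fixed root and add up
  these flows; the demand at the root cancels because \<open>b\<close> has total \<open>0\<close>.
  Negative values allow arcs to be used backwards.\<close>

lemma int_flow_with_boundary:
  fixes t h :: "'b \<Rightarrow> 'a" and b :: "'a \<Rightarrow> int"
  assumes "finite K" and "finite B"
    and ends: "\<And>a. a \<in> B \<Longrightarrow> t a \<in> K \<and> h a \<in> K"
    and conn: "\<And>S. \<lbrakk>S \<subset> K; S \<noteq> {}\<rbrakk> \<Longrightarrow> \<exists>a\<in>B. (t a \<in> S) \<noteq> (h a \<in> S)"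
    and "sum b K = 0"
  shows "\<exists>x :: 'b \<Rightarrow> int. \<forall>U\<subseteq>K. (\<Sum>a\<in>B. x a * (of_bool (t a \<in> U) - of_bool (h a \<in> U))) = sum b U"
proof (cases "K = {}")
  case True
  with ends have "B = {}" by auto
  with True show ?thesis by simp
next
  case False
  then obtain r where "r \<in> K" by blast
  define net :: "('b \<Rightarrow> int) \<Rightarrow> 'a set \<Rightarrow> int" where
    "net x U = (\<Sum>a\<in>B. x a * (of_bool (t a \<in> U) - of_bool (h a \<in> U)))" for x U
  define unit_flow where
    "unit_flow v x \<longleftrightarrow> (\<forall>U. net x U = of_bool (v \<in> U) - of_bool (r \<in> U))" for v x
  \<comment> \<open>Changing the flow by one on an arc moves its source from one end of the arc to
    the other.\<close>
  have extend: "unit_flow v' (x(a := x a + c))"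
    if "unit_flow v x" "a \<in> B" "c = 1 \<and> v = h a \<and> v' = t a \<or> c = - 1 \<and> v = t a \<and> v' = h a" for v v' x a c
  proof -
    have "net (x(a := x a + c)) U = net x U + c * (of_bool (t a \<in> U) - of_bool (h a \<in> U))" for U
      using \<open>finite B\<close> \<open>a \<in> B\<close> by (simp add: net_def sum.remove[of B a] distrib_right)
    then show ?thesis using that by (auto simp: unit_flow_def)
  qed
  define S where "S = {v \<in> K. \<exists>x. unit_flow v x}"
  have "unit_flow r (\<lambda>_. 0)" by (simp add: unit_flow_def net_def)
  then have "r \<in> S" using \<open>r \<in> K\<close> by (auto simp: S_def)
  \<comment> \<open>No arc of \<open>B\<close> leaves or enters \<open>S\<close>, as a unit flow
    extends along arcs in both directions; connectivity then gives all of \<open>K\<close>.\<close>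
  have "S = K"
  proof (rule ccontr)
    assume "S \<noteq> K"
    then have "S \<subset> K" by (auto simp: S_def)
    with conn \<open>r \<in> S\<close> obtain a where a: "a \<in> B" "(t a \<in> S) \<noteq> (h a \<in> S)" by blast
    then have "t a \<in> S \<longleftrightarrow> h a \<in> S"
      using ends[of a] extend[of "t a" _ a "-1" "h a"] extend[of "h a" _ a 1 "t a"]
      unfolding S_def by blast
    with a show False by blast
  qed
  then have "\<forall>v\<in>K. \<exists>x. unit_flow v x" by (auto simp: S_def)
  then obtain X where X: "\<And>v. v \<in> K \<Longrightarrow> unit_flow v (X v)" by metis
  define x where "x a = (\<Sum>v\<in>K. b v * X v a)" for a
  have "net x U = sum b U" if "U \<subseteq> K" for U
  proof -
    have "net x U = (\<Sum>v\<in>K. b v * net (X v) U)"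
      unfolding net_def x_def sum_distrib_left sum_distrib_right
      by (subst sum.swap) (simp add: mult.assoc)
    also have "\<dots> = (\<Sum>v\<in>K. b v * of_bool (v \<in> U) - b v * of_bool (r \<in> U))"
      using X by (intro sum.cong) (auto simp: unit_flow_def right_diff_distrib)
    also have "\<dots> = (\<Sum>v\<in>K. b v * of_bool (v \<in> U)) - sum b K * of_bool (r \<in> U)"
      by (simp add: sum_subtractf sum_distrib_right)
    also have "\<dots> = sum b (K \<inter> U)"
      using \<open>finite K\<close> \<open>sum b K = 0\<close> by (simp add: sum.inter_restrict of_bool_def if_distrib[of "\<lambda>x. _ * x"] cong: if_cong)
    also have "K \<inter> U = U" using that by blast
    finally show ?thesis .
  qed
  then show ?thesis unfolding net_def by blast
qed

text \<open>The vector from \<open>crossing_family_halving\<close> is realised as the net outflow of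
  an integral \<open>x\<close>. No arc enters a member of \<open>F\<close>, so the total of
  \<open>x\<close> on its cut lies strictly between \<open>0\<close> and the size of the cut.
  \<open>J\<close> consists of the arcs with \<open>1 \<le> x a\<close>.\<close>

lemma cuts_bicoloured_on_connected:
  fixes t h :: "'b \<Rightarrow> 'a"
  assumes "finite K" and "finite B"
    and ends: "\<And>a. a \<in> B \<Longrightarrow> t a \<in> K \<and> h a \<in> K"
    and conn: "\<And>S. \<lbrakk>S \<subset> K; S \<noteq> {}\<rbrakk> \<Longrightarrow> \<exists>a\<in>B. (t a \<in> S) \<noteq> (h a \<in> S)"
    and F: "crossing_family K F"
    and no_in: "\<And>I a. \<lbrakk>I \<in> F; a \<in> B; h a \<in> I\<rbrakk> \<Longrightarrow> t a \<in> I"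
    and two_out: "\<And>I. I \<in> F \<Longrightarrow> 2 \<le> card {a \<in> B. t a \<in> I \<and> h a \<notin> I}"
  shows "\<exists>J\<subseteq>B. \<forall>I\<in>F. (\<exists>a\<in>J. t a \<in> I \<and> h a \<notin> I) \<and> (\<exists>a\<in>B - J. t a \<in> I \<and> h a \<notin> I)"
proof -
  have subK: "I \<subseteq> K" if "I \<in> F" for I
    using that F by (auto simp: crossing_family_def)
  \<comment> \<open>Out-degree minus in-degree within \<open>B\<close>; on a member of
    \<open>F\<close> it adds up to the number of leaving arcs.\<close>
  define m :: "'a \<Rightarrow> int" where "m v = (\<Sum>a\<in>B. of_bool (t a = v) - of_bool (h a = v))" for v
  have ind: "(\<Sum>v\<in>U. of_bool (u = v) :: int) = of_bool (u \<in> U)" if "finite U" for u and U :: "'a set"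
    using that by (simp add: of_bool_def)
  have m: "sum m U = (\<Sum>a\<in>B. of_bool (t a \<in> U) - of_bool (h a \<in> U))" if "U \<subseteq> K" for U
    unfolding m_def using finite_subset[OF that \<open>finite K\<close>]
    by (subst sum.swap) (simp add: sum_subtractf ind del: sum_of_bool_eq)
  have out: "(\<Sum>a\<in>B. x a * (of_bool (t a \<in> I) - of_bool (h a \<in> I))) =
      sum x {a \<in> B. t a \<in> I \<and> h a \<notin> I}" if "I \<in> F" for I and x :: "'b \<Rightarrow> int"
    unfolding sum.inter_filter[OF \<open>finite B\<close>] using no_in[OF that]
    by (intro sum.cong) (auto simp: of_bool_def)
  have m_out: "sum m I = card {a \<in> B. t a \<in> I \<and> h a \<notin> I}" if "I \<in> F" for I
    using out[OF that, of "\<lambda>_. 1"] m[OF subK[OF that]] by simp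
  have "sum m K = 0"
    using m[of K] ends by simp
  moreover have "2 \<le> sum m I" if "I \<in> F" for I
    using two_out[OF that] m_out[OF that] by simp
  ultimately obtain b where b: "sum b K = 0" "\<forall>I\<in>F. 1 \<le> sum b I \<and> sum b I \<le> sum m I - 1"
    using crossing_family_halving[OF \<open>finite K\<close> F] by blast
  obtain x :: "'b \<Rightarrow> int" where
    x: "\<forall>U\<subseteq>K. (\<Sum>a\<in>B. x a * (of_bool (t a \<in> U) - of_bool (h a \<in> U))) = sum b U"
    using int_flow_with_boundary[OF assms(1-4) b(1)] by blast
  have "(\<exists>a\<in>{a \<in> B. 1 \<le> x a}. t a \<in> I \<and> h a \<notin> I) \<and> (\<exists>a\<in>B - {a \<in> B. 1 \<le> x a}. t a \<in> I \<and> h a \<notin> I)"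
    if "I \<in> F" for I
  proof -
    let ?O = "{a \<in> B. t a \<in> I \<and> h a \<notin> I}"
    \<comment> \<open>The first bound excludes that all values are at most \<open>0\<close>, the
      second that all are at least \<open>1\<close>.\<close>
    have sx: "1 \<le> sum x ?O" "sum x ?O < card ?O"
      using x b(2) subK[OF that] out[OF that, of x] m_out[OF that] that by force+
    have "\<exists>a\<in>?O. 1 \<le> x a"
    proof (rule ccontr)
      assume "\<not> (\<exists>a\<in>?O. 1 \<le> x a)"
      then have "sum x ?O \<le> 0" by (intro sum_nonpos) force
      with sx show False by simp
    qed
    moreover have "\<exists>a\<in>?O. \<not> 1 \<le> x a"
    proof (rule ccontr)
      assume "\<not> (\<exists>a\<in>?O. \<not> 1 \<le> x a)"
      then have "(\<Sum>a\<in>?O. 1) \<le> sum x ?O" by (intro sum_mono) blast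
      with sx show False by simp
    qed
    ultimately show ?thesis by blast
  qed
  then show ?thesis by (intro exI[of _ "{a \<in> B. 1 \<le> x a}"]) blast
qed

section \<open>Weak components and bridges\<close>

context wf_digraph
begin

text \<open>Reachability in a symmetric digraph is symmetric, so the maximality condition for strong
  components becomes one-sided and the components are the reachability classes.\<close>

lemma weak_components_iff:
  "S \<in> weak_components G \<longleftrightarrow> S \<noteq> {} \<and> (\<forall>u\<in>S. \<forall>v. u \<rightarrow>\<^sup>*\<^bsub>with_proj (mk_symmetric G)\<^esub> v \<longleftrightarrow> v \<in> S)"
proof -
  let ?R = "reachable (with_proj (mk_symmetric G))"
  have "?R u v \<Longrightarrow> ?R v u" for u v
    by (rule symmetric_reachable[OF symmetric_mk_symmetric])
  then have sym: "(\<not> ?R u v \<or> \<not> ?R v u) = (\<not> ?R u v)" for u v by (cases "?R u v") simp_all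
  show ?thesis
    unfolding weak_components_def pre_digraph.sccs_verts_def mem_Collect_eq sym by blast
qed

lemma weak_component_reachable_iff:
  assumes "S \<in> weak_components G" and "u \<in> S"
  shows "u \<rightarrow>\<^sup>*\<^bsub>with_proj (mk_symmetric G)\<^esub> v \<longleftrightarrow> v \<in> S"
proof -
  from assms(1) have "\<forall>u\<in>S. \<forall>v. u \<rightarrow>\<^sup>*\<^bsub>with_proj (mk_symmetric G)\<^esub> v \<longleftrightarrow> v \<in> S"
    unfolding weak_components_iff by (rule conjunct2)
  from this assms(2) have "\<forall>v. u \<rightarrow>\<^sup>*\<^bsub>with_proj (mk_symmetric G)\<^esub> v \<longleftrightarrow> v \<in> S"
    by (rule bspec)
  then show ?thesis by (rule spec)
qed

lemma mk_symmetric_reachable_closed: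
  assumes "u \<rightarrow>\<^sup>*\<^bsub>with_proj (mk_symmetric G)\<^esub> v" and "u \<in> T"
    and "\<And>a. a \<in> arcs G \<Longrightarrow> tail G a \<in> T \<longleftrightarrow> head G a \<in> T"
  shows "v \<in> T"
proof -
  interpret S: pair_wf_digraph "mk_symmetric G" by (rule wellformed_mk_symmetric)
  from assms(1) show ?thesis
    by (induction rule: S.reachable_induct) (use assms(2,3) in \<open>auto simp: parcs_mk_symmetric\<close>)
qed

lemma weak_component_arc:
  assumes "S \<in> weak_components G" and "a \<in> arcs G"
  shows "tail G a \<in> S \<longleftrightarrow> head G a \<in> S"
proof -
  interpret S: pair_wf_digraph "mk_symmetric G" by (rule wellformed_mk_symmetric)
  have "tail G a \<rightarrow>\<^sup>*\<^bsub>with_proj (mk_symmetric G)\<^esub> head G a" "head G a \<rightarrow>\<^sup>*\<^bsub>with_proj (mk_symmetric G)\<^esub> tail G a"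
    using assms(2) by (auto intro!: S.reachable_adjI simp: parcs_mk_symmetric)
  then show ?thesis
    using weak_component_reachable_iff[OF assms(1), of "tail G a" "head G a"]
      weak_component_reachable_iff[OF assms(1), of "head G a" "tail G a"] by blast
qed

lemma weak_components_eq:
  assumes "S \<in> weak_components G" and "S' \<in> weak_components G" and "v \<in> S" and "v \<in> S'"
  shows "S = S'"
proof (rule set_eqI)
  show "x \<in> S \<longleftrightarrow> x \<in> S'" for x
    using weak_component_reachable_iff[OF assms(1,3), symmetric] weak_component_reachable_iff[OF assms(2,4)]
    by (rule trans)
qed

lemma weak_components_cover:
  assumes "v \<in> verts G"
  obtains S where "S \<in> weak_components G" and "v \<in> S"
proof
  interpret S: pair_wf_digraph "mk_symmetric G" by (rule wellformed_mk_symmetric)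
  let ?R = "reachable (with_proj (mk_symmetric G))"
  let ?S = "{u. ?R v u}"
  show v: "v \<in> ?S" using assms by simp
  have reach: "?R u u' \<longleftrightarrow> ?R v u'" if "?R v u" for u u'
  proof
    show "?R v u'" if "?R u u'" using \<open>?R v u\<close> that by (rule S.reachable_trans)
    have "?R u v" using symmetric_mk_symmetric \<open>?R v u\<close> by (rule symmetric_reachable)
    then show "?R u u'" if "?R v u'" using that by (rule S.reachable_trans)
  qed
  show "?S \<in> weak_components G"
    unfolding weak_components_iff
  proof (intro conjI ballI allI)
    show "?S \<noteq> {}" using v by blast
    show "?R u u' \<longleftrightarrow> u' \<in> ?S" if "u \<in> ?S" for u u'
      using that unfolding mem_Collect_eq by (rule reach)
  qed
qed

lemma weak_component_subset_verts:
  assumes "S \<in> weak_components G"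
  shows "S \<subseteq> verts G"
proof
  fix v assume "v \<in> S"
  with assms have "v \<rightarrow>\<^sup>*\<^bsub>with_proj (mk_symmetric G)\<^esub> v" by (simp add: weak_components_iff)
  then show "v \<in> verts G" by (rule reachable_in_vertsE) simp
qed

text \<open>If no arc crossed \<open>T\<close>, then \<open>T\<close> would be closed under
  reachability, and \<open>v\<close> could not be reached from \<open>u\<close>.\<close>

lemma weak_component_crossing_arc:
  assumes "S \<in> weak_components G" and "u \<in> S \<inter> T" and "v \<in> S - T"
  obtains a where "a \<in> arcs G" and "(tail G a \<in> T) \<noteq> (head G a \<in> T)"
proof -
  have "u \<rightarrow>\<^sup>*\<^bsub>with_proj (mk_symmetric G)\<^esub> v"
    using weak_component_reachable_iff[OF assms(1), of u v] assms(2,3) by blast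
  then show thesis
    using mk_symmetric_reachable_closed[of u v T] assms(2,3) that by blast
qed

end

lemma (in fin_digraph) finite_weak_components: "finite (weak_components G)"
  using weak_component_subset_verts
  by (intro finite_subset[of "weak_components G" "Pow (verts G)"]) auto

text \<open>Each component left after deleting \<open>e\<close> lies in an old one. This assignment
  is onto and sends the two distinct components at the ends of \<open>e\<close> to \<open>K\<close>,
  so the number of components grows.\<close>

lemma (in fin_digraph) bridge_if_unique_crossing:
  assumes K: "K \<in> weak_components G" and e: "e \<in> arcs G" and "tail G e \<in> K"
    and cross: "(tail G e \<in> T) \<noteq> (head G e \<in> T)"
    and uniq: "\<And>a. \<lbrakk>a \<in> arcs G; tail G a \<in> K; (tail G a \<in> T) \<noteq> (head G a \<in> T)\<rbrakk> \<Longrightarrow> a = e"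
  shows "e \<in> bridges G"
proof -
  let ?H = "del_arc e"
  interpret H: fin_digraph ?H by (rule fin_digraph_del_arc)
  have sub: "\<exists>Y\<in>weak_components G. X \<subseteq> Y" if X: "X \<in> weak_components ?H" for X
  proof -
    obtain x where x: "x \<in> X" using X by (auto simp: H.weak_components_iff)
    then have "x \<in> verts G" using H.weak_component_subset_verts[OF X] by auto
    then obtain Y where Y: "Y \<in> weak_components G" "x \<in> Y" by (rule weak_components_cover)
    have "X \<subseteq> Y"
    proof (rule ccontr)
      assume "\<not> X \<subseteq> Y"
      then obtain v where "v \<in> X - Y" by blast
      with X x Y obtain a where "a \<in> arcs ?H" "(tail ?H a \<in> Y) \<noteq> (head ?H a \<in> Y)"
        using H.weak_component_crossing_arc[of X x Y v] by blast
      with weak_component_arc[OF Y(1)] show False by auto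
    qed
    with Y show ?thesis by blast
  qed
  then obtain f where f: "\<And>X. X \<in> weak_components ?H \<Longrightarrow> f X \<in> weak_components G \<and> X \<subseteq> f X"
    by metis
  obtain X1 where X1: "X1 \<in> weak_components ?H" "tail G e \<in> X1"
    using H.weak_components_cover[of "tail G e"] e by auto
  obtain X2 where X2: "X2 \<in> weak_components ?H" "head G e \<in> X2"
    using H.weak_components_cover[of "head G e"] e by auto
  have hK: "head G e \<in> K" using weak_component_arc[OF K e] \<open>tail G e \<in> K\<close> by blast
  have f12: "f X1 = K" "f X2 = K"
    using f[OF X1(1)] f[OF X2(1)] X1(2) X2(2) K hK \<open>tail G e \<in> K\<close> weak_components_eq by blast+
  have "X1 \<noteq> X2"
  proof
    assume "X1 = X2"
    \<comment> \<open>The side of the cut within \<open>K\<close> that contains the tail of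
      \<open>e\<close>; an arc of \<open>?H\<close> crossing it would be a second crossing arc in
      \<open>K\<close>.\<close>
    let ?T = "if tail G e \<in> T then K \<inter> T else K - T"
    have "tail G e \<in> X1 \<inter> ?T" "head G e \<in> X1 - ?T"
      using X1 X2 \<open>X1 = X2\<close> cross \<open>tail G e \<in> K\<close> hK by auto
    then obtain a where a: "a \<in> arcs ?H" "(tail ?H a \<in> ?T) \<noteq> (head ?H a \<in> ?T)"
      by (rule H.weak_component_crossing_arc[OF X1(1)])
    then have "a \<in> arcs G" "a \<noteq> e" by auto
    moreover have "tail G a \<in> K \<longleftrightarrow> head G a \<in> K"
      using weak_component_arc[OF K \<open>a \<in> arcs G\<close>] .
    then have "tail G a \<in> K" "(tail G a \<in> T) \<noteq> (head G a \<in> T)"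
      using a(2) by (auto split: if_splits)
    ultimately show False using uniq by blast
  qed
  \<comment> \<open>Leaving out \<open>X2\<close> loses no image, because \<open>X1\<close> has the
    same image \<open>K\<close>.\<close>
  have "weak_components G \<subseteq> f ` (weak_components ?H - {X2})"
  proof
    fix Y assume Y: "Y \<in> weak_components G"
    then obtain y where y: "y \<in> Y" by (auto simp: weak_components_iff)
    then have "y \<in> verts ?H" using weak_component_subset_verts[OF Y] by auto
    then obtain X where X: "X \<in> weak_components ?H" "y \<in> X" by (rule H.weak_components_cover)
    then have "f X = Y" using f[OF X(1)] Y y weak_components_eq by blast
    moreover have "f X1 = f X2" using f12 by simp
    ultimately show "Y \<in> f ` (weak_components ?H - {X2})"
      using X X1 \<open>X1 \<noteq> X2\<close> by (cases "X = X2") auto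
  qed
  then have "card (weak_components G) \<le> card (weak_components ?H - {X2})"
    using H.finite_weak_components by (meson card_image_le card_mono finite_Diff finite_imageI le_trans)
  also have "\<dots> < card (weak_components ?H)"
    using H.finite_weak_components X2(1) by (rule card_Diff1_less)
  finally show ?thesis using e by (simp add: bridges_def)
qed

section \<open>Two disjoint dijoins\<close>

theorem theorem2:
  fixes D :: "('a,'b) pre_digraph" and w :: "'b \<Rightarrow> nat" and A1 :: "'b set"
  assumes "fin_digraph D"
    and "\<forall>a \<in> arcs D. w a \<in> {0, 1}"
    and "\<forall>C. dicut D C \<longrightarrow> (\<Sum>a\<in>C. w a) \<ge> 2"
    and "A1 = {a \<in> arcs D. w a = 1}"
    and "weakly_bridge_connected (arc_subdigraph D A1)"
  shows "\<exists>J1 J2. dijoin D J1 \<and> dijoin D J2 \<and> J1 \<inter> J2 = {} \<and> J1 \<subseteq> A1 \<and> J2 \<subseteq> A1"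
proof -
  interpret D: fin_digraph D by fact
  have A1: "A1 \<subseteq> arcs D" "finite A1" using assms(4) by auto
  define G where "G = arc_subdigraph D A1"
  have G_simps [simp]: "arcs G = A1" "tail G = tail D" "head G = head D" "verts G = tail D ` A1 \<union> head D ` A1"
    by (simp_all add: G_def arc_subdigraph_def)
  interpret G: fin_digraph G
    using A1 by unfold_locales auto
  have verts_sub: "K \<subseteq> verts D" if "K \<in> weak_components G" for K
  proof -
    have "verts G \<subseteq> verts D" using A1 by auto
    then show ?thesis using G.weak_component_subset_verts[OF that] by blast
  qed
  note same_comp = G.weak_component_arc[simplified]
  note crossing_arc = G.weak_component_crossing_arc[unfolded G_simps(1-3)]
  note comp_eq = G.weak_components_eq
  \<comment> \<open>The component with all bridges; the value \<open>{}\<close>, which is never a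
    component, covers the bridgeless case.\<close>
  obtain C0 where C0: "C0 \<in> weak_components G \<or> C0 = {}" "\<forall>e\<in>bridges G. tail D e \<in> C0"
    using assms(5) unfolding weakly_bridge_connected_def G_def[symmetric] by (cases "bridges G = {}") auto
  have two: "2 \<le> card (out_cut D U \<inter> A1)"
    if U: "U \<subseteq> verts D" "in_cut D U = {}" "U \<noteq> {}" "U \<noteq> verts D" for U
  proof -
    have "dicut D (out_cut D U)" using U unfolding dicut_def by blast
    then have "2 \<le> sum w (out_cut D U)" using assms(3) by blast
    also have "\<dots> = (\<Sum>a\<in>out_cut D U. if a \<in> A1 then 1 else 0)"
      using assms(2,4) by (intro sum.cong) (auto simp: out_cut_def)
    also have "\<dots> = card (out_cut D U \<inter> A1)"
      by (subst sum.inter_restrict[symmetric]) (simp_all add: out_cut_def)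
    finally show ?thesis .
  qed
  define split_by where "split_by U K \<longleftrightarrow> K \<inter> U \<noteq> {} \<and> \<not> K \<subseteq> U" for U K :: "'a set"
  define F where "F K = {U \<inter> K |U. U \<subseteq> verts D \<and> in_cut D U = {} \<and> split_by U K \<and>
    (K = C0 \<longrightarrow> (\<forall>L\<in>weak_components G - {K}. \<not> split_by U L))}" for K
  have F_I: "U \<inter> K \<in> F K" if "U \<subseteq> verts D" "in_cut D U = {}" "split_by U K"
    "\<And>L. \<lbrakk>K = C0; L \<in> weak_components G - {K}\<rbrakk> \<Longrightarrow> \<not> split_by U L" for U K
    unfolding F_def using that by blast
  define B where "B K = {a \<in> A1. tail D a \<in> K}" for K
  have "\<exists>J\<subseteq>B K. \<forall>I\<in>F K. (\<exists>a\<in>J. tail D a \<in> I \<and> head D a \<notin> I) \<and>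
      (\<exists>a\<in>B K - J. tail D a \<in> I \<and> head D a \<notin> I)"
    if K: "K \<in> weak_components G" for K
  proof (rule cuts_bicoloured_on_connected)
    show "finite K" using verts_sub[OF K] by (rule finite_subset) simp
    show "finite (B K)" using A1 by (simp add: B_def)
    show "tail D a \<in> K \<and> head D a \<in> K" if "a \<in> B K" for a
      using that same_comp[OF K, of a] by (auto simp: B_def)
    show "\<exists>a\<in>B K. (tail D a \<in> S) \<noteq> (head D a \<in> S)" if S: "S \<subset> K" "S \<noteq> {}" for S
    proof -
      obtain u v where "u \<in> K \<inter> S" "v \<in> K - S" using S by blast
      then obtain a where a: "a \<in> A1" "(tail D a \<in> S) \<noteq> (head D a \<in> S)"
        by (rule crossing_arc[OF K])
      then have "a \<in> B K" using S same_comp[OF K a(1)] by (auto simp: B_def)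
      with a show ?thesis by blast
    qed
    show "crossing_family K (F K)"
      unfolding crossing_family_def
    proof (intro conjI ballI impI)
      show "F K \<subseteq> Pow K" by (auto simp: F_def)
      fix I I'
      assume I: "I \<in> F K" and I': "I' \<in> F K" and ne: "I \<inter> I' \<noteq> {}" "I \<union> I' \<noteq> K"
      obtain U where U: "I = U \<inter> K" "U \<subseteq> verts D" "in_cut D U = {}" "split_by U K"
        "K = C0 \<Longrightarrow> \<forall>L\<in>weak_components G - {K}. \<not> split_by U L"
        using I unfolding F_def by blast
      obtain U' where U': "I' = U' \<inter> K" "U' \<subseteq> verts D" "in_cut D U' = {}" "split_by U' K"
        "K = C0 \<Longrightarrow> \<forall>L\<in>weak_components G - {K}. \<not> split_by U' L"
        using I' unfolding F_def by blast
      have cut: "in_cut D (U \<inter> U') = {}" "in_cut D (U \<union> U') = {}"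
        using U(3) U'(3) unfolding in_cut_def by blast+
      \<comment> \<open>The two crossing conditions say exactly that the intersection and the union
        still split \<open>K\<close>.\<close>
      have split: "split_by (U \<inter> U') K" "split_by (U \<union> U') K"
        using ne U(1,4) U'(1,4) unfolding split_by_def by blast+
      \<comment> \<open>A component that is not split is inside or outside each side, hence also
        inside or outside their intersection and union.\<close>
      have no_split: "\<not> split_by (U \<inter> U') L" "\<not> split_by (U \<union> U') L"
        if "K = C0" "L \<in> weak_components G - {K}" for L
      proof -
        have "\<not> split_by U L" "\<not> split_by U' L" using U(5) U'(5) that by blast+
        then show "\<not> split_by (U \<inter> U') L" "\<not> split_by (U \<union> U') L"
          unfolding split_by_def by blast+
      qed
      have sub: "U \<inter> U' \<subseteq> verts D" "U \<union> U' \<subseteq> verts D"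
        using U(2) U'(2) by blast+
      have eq: "I \<inter> I' = (U \<inter> U') \<inter> K" "I \<union> I' = (U \<union> U') \<inter> K"
        using U(1) U'(1) by blast+
      show "I \<inter> I' \<in> F K"
        unfolding eq using sub(1) cut(1) split(1) no_split(1) by (rule F_I)
      show "I \<union> I' \<in> F K"
        unfolding eq using sub(2) cut(2) split(2) no_split(2) by (rule F_I)
    qed
    show no_in: "tail D a \<in> I" if I: "I \<in> F K" and a: "a \<in> B K" "head D a \<in> I" for I a
    proof -
      obtain U where U: "I = U \<inter> K" "in_cut D U = {}"
        using I by (auto simp: F_def)
      have "a \<in> arcs D" "tail D a \<in> K" "tail D a \<in> verts D"
        using a(1) A1 by (auto simp: B_def)
      with U a(2) show ?thesis unfolding in_cut_def by blast
    qed
    show "2 \<le> card {a \<in> B K. tail D a \<in> I \<and> head D a \<notin> I}" (is "_ \<le> card ?O")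
      if I: "I \<in> F K" for I
    proof -
      obtain U where U: "I = U \<inter> K" "U \<subseteq> verts D" "in_cut D U = {}" "split_by U K"
        "K = C0 \<Longrightarrow> \<forall>L\<in>weak_components G - {K}. \<not> split_by U L"
        using I unfolding F_def by blast
      have "finite ?O" using A1 by (simp add: B_def)
      show ?thesis
      proof (cases "K = C0")
        case True
        \<comment> \<open>An arc of \<open>A1\<close> leaving \<open>U\<close> splits its own
          component, which can only be \<open>K\<close>; the bound on the whole dicut thus passes to
          \<open>K\<close>.\<close>
        have "out_cut D U \<inter> A1 \<subseteq> ?O"
        proof
          fix a assume a: "a \<in> out_cut D U \<inter> A1"
          then have cut: "tail D a \<in> U" "head D a \<notin> U" by (auto simp: out_cut_def)
          obtain L where L: "L \<in> weak_components G" "tail D a \<in> L"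
            using G.weak_components_cover[of "tail D a"] a by auto
          then have "head D a \<in> L" using same_comp[of L a] a by blast
          with L cut have "split_by U L" unfolding split_by_def by blast
          with U(5)[OF True] L have "L = K" by blast
          with L a cut \<open>head D a \<in> L\<close> U(1) show "a \<in> ?O" by (simp add: B_def)
        qed
        then have "card (out_cut D U \<inter> A1) \<le> card ?O"
          using \<open>finite ?O\<close> by (rule card_mono[rotated])
        moreover have "U \<noteq> {}" "U \<noteq> verts D"
          using U(4) verts_sub[OF K] unfolding split_by_def by blast+
        ultimately show ?thesis using two[OF U(2,3)] by simp
      next
        case False
        have O: "a \<in> ?O" if "a \<in> A1" "tail D a \<in> K" "(tail D a \<in> U) \<noteq> (head D a \<in> U)" for a
        proof -
          have "a \<in> B K" "head D a \<in> K" using that same_comp[OF K, of a] by (auto simp: B_def)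
          then show ?thesis using no_in[OF I] that U(1) by blast
        qed
        obtain u v where "u \<in> K \<inter> (U \<inter> K)" "v \<in> K - (U \<inter> K)"
          using U(4) unfolding split_by_def by blast
        then obtain e where e: "e \<in> A1" "(tail D e \<in> U \<inter> K) \<noteq> (head D e \<in> U \<inter> K)"
          by (rule crossing_arc[OF K])
        then have eK: "tail D e \<in> K" "(tail D e \<in> U) \<noteq> (head D e \<in> U)"
          using same_comp[OF K] by blast+
        \<comment> \<open>Connectivity gives one crossing arc; were it the only one, it would be a
          bridge outside \<open>C0\<close>.\<close>
        show ?thesis
        proof (rule ccontr)
          assume "\<not> 2 \<le> card ?O"
          moreover have "{e} \<subseteq> ?O" using O[OF e(1) eK] by blast
          ultimately have "?O = {e}"
            using \<open>finite ?O\<close> card_seteq[of ?O "{e}"] by simp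
          then have "a = e" if "a \<in> A1" "tail D a \<in> K" "(tail D a \<in> U) \<noteq> (head D a \<in> U)" for a
            using O[OF that] by blast
          with e(1) eK have "e \<in> bridges G"
            by (rule G.bridge_if_unique_crossing[OF K, unfolded G_simps(1-3)])
          then have "tail D e \<in> C0" using C0(2) by blast
          then show False using C0(1) comp_eq[OF K _ eK(1)] False by blast
        qed
      qed
    qed
  qed
  then obtain J where JB: "\<And>K. K \<in> weak_components G \<Longrightarrow> J K \<subseteq> B K"
    and J: "\<And>K I. \<lbrakk>K \<in> weak_components G; I \<in> F K\<rbrakk> \<Longrightarrow>
      (\<exists>a\<in>J K. tail D a \<in> I \<and> head D a \<notin> I) \<and> (\<exists>a\<in>B K - J K. tail D a \<in> I \<and> head D a \<notin> I)"
    by metis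
  \<comment> \<open>The second dijoin is the complement \<open>A1 - J1\<close>.\<close>
  define J1 where "J1 = (\<Union>K\<in>weak_components G. J K)"
  have J1_A1: "J1 \<subseteq> A1" using JB by (auto simp: J1_def B_def)
  have meets: "J1 \<inter> C \<noteq> {} \<and> (A1 - J1) \<inter> C \<noteq> {}" if dicut: "dicut D C" for C
  proof -
    obtain U where U: "U \<noteq> {}" "U \<subseteq> verts D" "U \<noteq> verts D" "in_cut D U = {}" and C: "C = out_cut D U"
      using dicut unfolding dicut_def by blast
    \<comment> \<open>A split component other than \<open>C0\<close> serves at once. If there is
      none, an arc of \<open>A1\<close> in the dicut shows that \<open>C0\<close> is split, and then
      it is the only split component.\<close>
    have "\<exists>K\<in>weak_components G. U \<inter> K \<in> F K"
    proof (cases "\<exists>L\<in>weak_components G - {C0}. split_by U L")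
      case True
      then show ?thesis using F_I[OF U(2,4)] by blast
    next
      case False
      have "out_cut D U \<inter> A1 \<noteq> {}" using two[OF U(2,4,1,3)] by force
      then obtain a where a: "a \<in> out_cut D U" "a \<in> A1" by blast
      obtain K where K: "K \<in> weak_components G" "tail D a \<in> K"
        using G.weak_components_cover[of "tail D a"] a by auto
      then have "head D a \<in> K" using same_comp[of K a] a by blast
      with K a have "split_by U K" unfolding split_by_def out_cut_def by blast
      with K False show ?thesis using F_I[OF U(2,4)] by blast
    qed
    then obtain K where K: "K \<in> weak_components G" and "U \<inter> K \<in> F K" by blast
    with J obtain a1 a2 where a1: "a1 \<in> J K" "tail D a1 \<in> U \<inter> K" "head D a1 \<notin> U \<inter> K"
      and a2: "a2 \<in> B K - J K" "tail D a2 \<in> U \<inter> K" "head D a2 \<notin> U \<inter> K" by meson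
    have in_C: "a \<in> C" if "a \<in> B K" "tail D a \<in> U \<inter> K" "head D a \<notin> U \<inter> K" for a
      using that same_comp[OF K, of a] A1 by (auto simp: C out_cut_def B_def)
    have "a1 \<in> C" using a1 JB[OF K] in_C by blast
    moreover have "a1 \<in> J1" using a1(1) K by (auto simp: J1_def)
    moreover have "a2 \<in> C" using a2 in_C by blast
    \<comment> \<open>The sets \<open>B K\<close> of different components are disjoint, so
      \<open>a2\<close> could only have come from \<open>J K\<close>.\<close>
    moreover have "a2 \<notin> J1"
    proof
      assume "a2 \<in> J1"
      then obtain L where L: "L \<in> weak_components G" "a2 \<in> J L" by (auto simp: J1_def)
      then have "tail D a2 \<in> L" using JB by (auto simp: B_def)
      then have "L = K" using comp_eq[OF L(1) K] a2(2) by blast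
      with L a2 show False by blast
    qed
    moreover have "a2 \<in> A1" using a2 by (auto simp: B_def)
    ultimately show ?thesis by blast
  qed
  show ?thesis
  proof (intro exI conjI)
    show "dijoin D J1" "dijoin D (A1 - J1)"
      using meets J1_A1 A1 unfolding dijoin_def by blast+
  qed (use J1_A1 in blast)+
qed

end
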